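(* The representation variety $\mathrm{Hom}(\mathbb{Z}^2,\mathrm{Heis}_0)$ is isomorphic, as a real algebraic variety, to the product $V\times\mathbb{R}^2$, where $V$ is the 3-dimensional variety $V=\{(x,y,z,w)\in\mathbb{R}^4\mid xy=zw\}$. Topologically, this is homeomorphic to the product of a plane with the (open) cone on a torus.
   Context: $\mathrm{Heis}_0$ is the real Heisenberg group of matrices $\begin{pmatrix}1&a&c\\0&1&b\\0&0&1\end{pmatrix}$ with $a,b,c\in\mathbb{R}$, regarded as an algebraic subvariety of the affine space of $3\times 3$ real matrices. Evaluation on the standard generators $e_1,e_2$ of $\mathbb{Z}^2$ identifies $\mathrm{Hom}(\mathbb{Z}^2,\mathrm{Heis}_0)$ with the algebraic subset $\{(A,B)\in\mathrm{Heis}_0\times\mathrm{Heis}_0 \mid AB=BA\}$, and the set of homomorphisms is given the resulting structure of a real algebraic variety. An isomorphism of varieties is a polynomial bijection with polynomial inverse. *)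

theory Defs
  imports
    "HOL-Analysis.Analysis"
    "HOL-Algebra.Elementary_Groups"
begin

section \<open>Real algebraic varieties in a Euclidean space\<close>

definition algebraic_set :: "'a::euclidean_space set \<Rightarrow> bool" where
  "algebraic_set S \<longleftrightarrow>
     (\<exists>P. (\<forall>p\<in>P. real_polynomial_function p) \<and> S = {x. \<forall>p\<in>P. p x = 0})"

definition isomorphic_varieties ::
    "'a::euclidean_space set \<Rightarrow> 'b::euclidean_space set \<Rightarrow> bool" where
  "isomorphic_varieties S T \<longleftrightarrow>
     algebraic_set S \<and> algebraic_set T \<and>
     (\<exists>f g. polynomial_function f \<and> polynomial_function g \<and>
            bij_betw f S T \<and> (\<forall>x\<in>S. g (f x) = x))"

definition irreducible_variety :: "'a::euclidean_space set \<Rightarrow> bool" where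
  "irreducible_variety S \<longleftrightarrow>
     algebraic_set S \<and> S \<noteq> {} \<and>
     (\<forall>A B. algebraic_set A \<and> algebraic_set B \<and> S = A \<union> B \<longrightarrow> A = S \<or> B = S)"

text \<open>Krull dimension of the Zariski topology: the supremum of the lengths \<open>n\<close> of chains
  \<open>Z 0 \<subset> \<dots> \<subset> Z n\<close> of irreducible algebraic subsets. (The empty variety gets the value 0.)\<close>

definition variety_dim :: "'a::euclidean_space set \<Rightarrow> enat" where
  "variety_dim S =
     Sup {enat n | n. \<exists>Z. (\<forall>i\<le>n. irreducible_variety (Z i) \<and> Z i \<subseteq> S) \<and>
                          (\<forall>i<n. Z i \<subset> Z (Suc i))}"

section \<open>The representation variety\<close>

definition heis_mat :: "real \<Rightarrow> real \<Rightarrow> real \<Rightarrow> real^3^3" where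
  "heis_mat a b c = vector [vector [1, a, c],
                            vector [0, 1, b],
                            vector [0, 0, 1]]"

definition Heis0 :: "(real^3^3) monoid" where
  "Heis0 = \<lparr>carrier = {heis_mat a b c | a b c. True}, monoid.mult = (**), one = mat 1\<rparr>"

abbreviation Z2 :: "(int \<times> int) monoid" where
  "Z2 \<equiv> integer_group \<times>\<times> integer_group"

definition eval_gens :: "(int \<times> int \<Rightarrow> 'a) \<Rightarrow> 'a \<times> 'a" where
  "eval_gens \<phi> = (\<phi> (1, 0), \<phi> (0, 1))"

text \<open>The set of homomorphisms, identified with a subset of the space of pairs of matrices by
  evaluation on the standard generators. The lemma \<open>bij_betw_eval_gens\<close> below shows that nothing
  is lost and that the result is the set of commuting pairs.\<close>

definition Hom_Z2_Heis0 :: "((real^3^3) \<times> (real^3^3)) set" where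
  "Hom_Z2_Heis0 = eval_gens ` hom Z2 Heis0"

lemma heis_mat_mult:
  "heis_mat a b c ** heis_mat a' b' c' = heis_mat (a + a') (b + b') (c + c' + a * b')"
  by (simp add: heis_mat_def matrix_matrix_mult_def vec_eq_iff forall_3 sum_3 vector_3)

lemma heis_mat_one: "mat 1 = heis_mat 0 0 0"
  by (simp add: heis_mat_def mat_def vec_eq_iff forall_3 vector_3)

lemma group_Heis0: "group Heis0"
proof (rule groupI)
  fix x assume "x \<in> carrier Heis0"
  then obtain a b c where x: "x = heis_mat a b c" by (auto simp: Heis0_def)
  have "heis_mat (-a) (-b) (a * b - c) ** x = mat 1"
    by (simp add: x heis_mat_mult heis_mat_one)
  then show "\<exists>y\<in>carrier Heis0. y \<otimes>\<^bsub>Heis0\<^esub> x = \<one>\<^bsub>Heis0\<^esub>"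
    by (auto simp: Heis0_def)
qed (auto simp: Heis0_def heis_mat_mult matrix_mul_assoc, auto simp: heis_mat_one)

lemma bij_betw_eval_gens:
  "bij_betw eval_gens (hom Z2 Heis0)
     {(A, B). A \<in> carrier Heis0 \<and> B \<in> carrier Heis0 \<and> A ** B = B ** A}"
proof -
  interpret H: group Heis0 by (rule group_Heis0)
  have Z2: "group Z2" by (simp add: DirProd_group)
  have m: "x \<otimes>\<^bsub>Heis0\<^esub> y = x ** y" for x y by (simp add: Heis0_def)
  have mz: "x \<otimes>\<^bsub>Z2\<^esub> y = (fst x + fst y, snd x + snd y)" for x y
    by (cases x; cases y) (simp add: integer_group_def)
  have cz: "x \<in> carrier Z2" for x
    by (cases x) (simp add: integer_group_def)
  define \<psi> where "\<psi> = (\<lambda>p::(real^3^3) \<times> (real^3^3). \<lambda>z::int \<times> int.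
      (fst p [^]\<^bsub>Heis0\<^esub> fst z) \<otimes>\<^bsub>Heis0\<^esub> (snd p [^]\<^bsub>Heis0\<^esub> snd z))"
  have pz: "z [^]\<^bsub>Z2\<^esub> (n::nat) = (int n * fst z, int n * snd z)" for z n
  proof (induction n)
    case 0 show ?case by (simp add: integer_group_def)
  next
    case (Suc n) then show ?case
      using group.is_monoid[OF Z2] by (simp only: monoid.nat_pow_Suc mz) (simp add: algebra_simps)
  qed
  have iz: "inv\<^bsub>Z2\<^esub> z = (- fst z, - snd z)" for z
    by (rule group.inv_equality[OF Z2 _ cz cz]) (cases z, simp add: integer_group_def)
  have piz: "z [^]\<^bsub>Z2\<^esub> (n::int) = (n * fst z, n * snd z)" for z n
    by (cases "n < 0") (simp_all add: int_pow_def2 pz iz)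
  have inv1: "\<psi> (eval_gens \<phi>) = \<phi>" if "\<phi> \<in> hom Z2 Heis0" for \<phi>
  proof
    fix z :: "int \<times> int"
    have p: "\<phi> w [^]\<^bsub>Heis0\<^esub> (n::int) = \<phi> (w [^]\<^bsub>Z2\<^esub> n)" for w n
      using hom_int_pow[OF that cz Z2 group_Heis0] by simp
    have "\<phi> ((fst z, 0) \<otimes>\<^bsub>Z2\<^esub> (0, snd z)) = \<phi> (fst z, 0) \<otimes>\<^bsub>Heis0\<^esub> \<phi> (0, snd z)"
      using hom_mult[OF that cz cz] .
    then show "\<psi> (eval_gens \<phi>) z = \<phi> z"
      by (simp only: \<psi>_def eval_gens_def fst_conv snd_conv p piz) (simp add: mz del: mult_DirProd)
  qed
  have hom\<psi>: "\<psi> (A, B) \<in> hom Z2 Heis0" and inv2: "eval_gens (\<psi> (A, B)) = (A, B)"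
    if A: "A \<in> carrier Heis0" and B: "B \<in> carrier Heis0" and AB: "A ** B = B ** A" for A B
  proof -
    have com: "A [^]\<^bsub>Heis0\<^esub> (i::int) \<otimes>\<^bsub>Heis0\<^esub> B [^]\<^bsub>Heis0\<^esub> (j::int)
             = B [^]\<^bsub>Heis0\<^esub> j \<otimes>\<^bsub>Heis0\<^esub> A [^]\<^bsub>Heis0\<^esub> i" for i j
    proof -
      have pw: "X [^]\<^bsub>Heis0\<^esub> (k::int) \<otimes>\<^bsub>Heis0\<^esub> Y = Y \<otimes>\<^bsub>Heis0\<^esub> X [^]\<^bsub>Heis0\<^esub> k"
        if X: "X \<in> carrier Heis0" and Y: "Y \<in> carrier Heis0"
          and XY: "X \<otimes>\<^bsub>Heis0\<^esub> Y = Y \<otimes>\<^bsub>Heis0\<^esub> X" for X Y k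
      proof -
        have n: "X [^]\<^bsub>Heis0\<^esub> (n::nat) \<otimes>\<^bsub>Heis0\<^esub> Y = Y \<otimes>\<^bsub>Heis0\<^esub> X [^]\<^bsub>Heis0\<^esub> n" for n
          using H.group_commutes_pow[OF XY X Y] .
        show ?thesis
        proof (cases "k < 0")
          case True
          let ?P = "X [^]\<^bsub>Heis0\<^esub> nat (- k)"
          have P: "?P \<in> carrier Heis0" using X by simp
          have "Y \<otimes>\<^bsub>Heis0\<^esub> inv\<^bsub>Heis0\<^esub> ?P = inv\<^bsub>Heis0\<^esub> ?P \<otimes>\<^bsub>Heis0\<^esub> Y"
            using H.inv_solve_right'[of "inv\<^bsub>Heis0\<^esub> ?P \<otimes>\<^bsub>Heis0\<^esub> Y" Y ?P]
              H.inv_solve_left[of Y ?P "Y \<otimes>\<^bsub>Heis0\<^esub> ?P"] n[of "nat (- k)"] P Y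
            by (metis H.inv_closed H.m_assoc H.m_closed)
          moreover have "X [^]\<^bsub>Heis0\<^esub> k = inv\<^bsub>Heis0\<^esub> ?P"
            using True by (simp only: int_pow_def2 if_True)
          ultimately show ?thesis by (simp only:)
        next
          case False then show ?thesis by (simp only: int_pow_def2 if_False n)
        qed
      qed
      have "A [^]\<^bsub>Heis0\<^esub> i \<otimes>\<^bsub>Heis0\<^esub> B = B \<otimes>\<^bsub>Heis0\<^esub> A [^]\<^bsub>Heis0\<^esub> i"
        using pw[OF A B] AB by (simp add: m)
      from pw[OF B H.int_pow_closed[OF A] this[symmetric]] show ?thesis by simp
    qed
    show "\<psi> (A, B) \<in> hom Z2 Heis0"
    proof (rule homI)
      fix x y :: "int \<times> int"
      let ?a = "\<lambda>i. A [^]\<^bsub>Heis0\<^esub> (i::int)" and ?b = "\<lambda>i. B [^]\<^bsub>Heis0\<^esub> (i::int)"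
      have "\<psi> (A, B) (x \<otimes>\<^bsub>Z2\<^esub> y)
          = ?a (fst x) \<otimes>\<^bsub>Heis0\<^esub> (?a (fst y) \<otimes>\<^bsub>Heis0\<^esub> ?b (snd x)) \<otimes>\<^bsub>Heis0\<^esub> ?b (snd y)"
        using A B by (simp add: \<psi>_def mz H.int_pow_mult H.m_assoc del: mult_DirProd)
      also have "\<dots> = ?a (fst x) \<otimes>\<^bsub>Heis0\<^esub> (?b (snd x) \<otimes>\<^bsub>Heis0\<^esub> ?a (fst y)) \<otimes>\<^bsub>Heis0\<^esub> ?b (snd y)"
        by (simp only: com)
      also have "\<dots> = \<psi> (A, B) x \<otimes>\<^bsub>Heis0\<^esub> \<psi> (A, B) y"
        using A B by (simp add: \<psi>_def H.m_assoc)
      finally show "\<psi> (A, B) (x \<otimes>\<^bsub>Z2\<^esub> y) = \<psi> (A, B) x \<otimes>\<^bsub>Heis0\<^esub> \<psi> (A, B) y" .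
    qed (use A B in \<open>simp add: \<psi>_def\<close>)
    show "eval_gens (\<psi> (A, B)) = (A, B)"
      using A B by (simp add: eval_gens_def \<psi>_def)
  qed
  have into: "eval_gens \<phi> \<in> {(A, B). A \<in> carrier Heis0 \<and> B \<in> carrier Heis0 \<and> A ** B = B ** A}"
    if "\<phi> \<in> hom Z2 Heis0" for \<phi>
  proof -
    have "\<phi> (1, 0) ** \<phi> (0, 1) = \<phi> (1, 1)" "\<phi> (0, 1) ** \<phi> (1, 0) = \<phi> (1, 1)"
      using hom_mult[OF that cz cz, of "(1, 0)" "(0, 1)"] hom_mult[OF that cz cz, of "(0, 1)" "(1, 0)"]
      unfolding m mz by simp_all
    moreover have "\<phi> w \<in> carrier Heis0" for w
      by (rule hom_in_carrier[OF that cz])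
    ultimately show ?thesis
      unfolding eval_gens_def mem_Collect_eq case_prod_conv by metis
  qed
  show ?thesis
  proof (rule bij_betw_byWitness[where f' = \<psi>])
    show "eval_gens ` hom Z2 Heis0
        \<subseteq> {(A, B). A \<in> carrier Heis0 \<and> B \<in> carrier Heis0 \<and> A ** B = B ** A}"
      by (rule image_subsetI) (rule into)
    show "\<forall>\<phi>\<in>hom Z2 Heis0. \<psi> (eval_gens \<phi>) = \<phi>"
      by (rule ballI) (rule inv1)
    show "\<forall>p\<in>{(A, B). A \<in> carrier Heis0 \<and> B \<in> carrier Heis0 \<and> A ** B = B ** A}.
        eval_gens (\<psi> p) = p"
      using inv2 by (simp only: Ball_def mem_Collect_eq split_paired_All case_prod_conv) metis
    show "\<psi> ` {(A, B). A \<in> carrier Heis0 \<and> B \<in> carrier Heis0 \<and> A ** B = B ** A}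
        \<subseteq> hom Z2 Heis0"
      using hom\<psi> by (simp only: image_subset_iff Ball_def mem_Collect_eq split_paired_All case_prod_conv) metis
  qed
qed

lemma Hom_Z2_Heis0_eq:
  "Hom_Z2_Heis0 = {(A, B). A \<in> carrier Heis0 \<and> B \<in> carrier Heis0 \<and> A ** B = B ** A}"
  unfolding Hom_Z2_Heis0_def using bij_betw_eval_gens by (rule bij_betw_imp_surj_on)

definition V :: "(real^4) set" where
  "V = {v. v $ 1 * v $ 2 = v $ 3 * v $ 4}"

section \<open>The open cone on a torus\<close>

definition quotient_topology :: "'a topology \<Rightarrow> ('a \<Rightarrow> 'b) \<Rightarrow> 'b topology" where
  "quotient_topology X q =
     topology (\<lambda>U. U \<subseteq> q ` topspace X \<and> openin X {x \<in> topspace X. q x \<in> U})"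

lemma openin_quotient_topology:
  "openin (quotient_topology X q) U \<longleftrightarrow>
     U \<subseteq> q ` topspace X \<and> openin X {x \<in> topspace X. q x \<in> U}"
proof -
  have "istopology (\<lambda>U. U \<subseteq> q ` topspace X \<and> openin X {x \<in> topspace X. q x \<in> U})"
    unfolding istopology_def
  proof (intro conjI allI impI)
    fix S T
    assume "S \<subseteq> q ` topspace X \<and> openin X {x \<in> topspace X. q x \<in> S}"
      and "T \<subseteq> q ` topspace X \<and> openin X {x \<in> topspace X. q x \<in> T}"
    moreover have "{x \<in> topspace X. q x \<in> S \<inter> T}
        = {x \<in> topspace X. q x \<in> S} \<inter> {x \<in> topspace X. q x \<in> T}" by auto
    ultimately show "S \<inter> T \<subseteq> q ` topspace X" "openin X {x \<in> topspace X. q x \<in> S \<inter> T}"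
      by auto
  next
    fix \<K>
    assume K: "\<forall>K\<in>\<K>. K \<subseteq> q ` topspace X \<and> openin X {x \<in> topspace X. q x \<in> K}"
    have "{x \<in> topspace X. q x \<in> \<Union>\<K>} = (\<Union>K\<in>\<K>. {x \<in> topspace X. q x \<in> K})" by auto
    then show "\<Union>\<K> \<subseteq> q ` topspace X" "openin X {x \<in> topspace X. q x \<in> \<Union>\<K>}"
      using K by auto
  qed
  then show ?thesis by (simp add: quotient_topology_def)
qed

lemma topspace_quotient_topology: "topspace (quotient_topology X q) = q ` topspace X"
proof -
  have "openin (quotient_topology X q) (q ` topspace X)"
    by (simp add: openin_quotient_topology cong: conj_cong)
  then show ?thesis
    by (meson openin_quotient_topology openin_subset openin_topspace subset_antisym)
qed

lemma quotient_map_quotient_topology: "quotient_map X (quotient_topology X q) q"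
  by (simp add: quotient_map_def topspace_quotient_topology openin_quotient_topology)

text \<open>The quotient of \<open>X \<times> [0, 1)\<close> by \<open>X \<times> {0}\<close>; its points are the equivalence classes.\<close>

definition open_cone :: "'a topology \<Rightarrow> ('a \<times> real) set topology" where
  "open_cone X =
     quotient_topology (prod_topology X (top_of_set {0..<1}))
       (\<lambda>(x, t). if t = 0 then topspace X \<times> {0} else {(x, t)})"

definition torus :: "(complex \<times> complex) topology" where
  "torus = prod_topology (top_of_set (sphere 0 1)) (top_of_set (sphere 0 1))"

end

theory Submission
  imports Defs
begin

text \<open>
  A pair of Heisenberg matrices with coordinates \<open>(a, b, c)\<close> and \<open>(a', b', c')\<close> commutes if and only
  if \<open>a b' = a' b\<close>; the corner entries \<open>c, c'\<close> are free. The linear map that reads off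
  \<open>((a, b', a', b), (c, c'))\<close> is therefore an isomorphism onto \<open>V \<times> \<real>\<^sup>2\<close>, and, being polynomial in
  both directions, also a homeomorphism.

  Dimension. The variety \<open>V\<close> is the image of \<open>\<real>\<^sup>4\<close> under
  \<open>segre (s, v, t, u) = (st, vu, su, vt)\<close>, so it is irreducible; intersecting with coordinate
  subspaces gives a chain of length 3 (\<open>variety_dim_V_ge\<close>). For the upper bound, algebraic independence replaces
  the dimension theory of rings. Going up one step in a chain \<open>Z \<subset> Z'\<close> of irreducible sets, a
  polynomial that vanishes on \<open>Z\<close> but not on \<open>Z'\<close> can be added to any family that is algebraically
  independent on \<open>Z\<close>, and the result is independent on \<open>Z'\<close> (\<open>alg_indep_Cons\<close>). A chain of length 4
  in \<open>V\<close> would hence give four polynomials that are algebraically independent on \<open>V\<close>. This is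
  impossible by counting: the \<open>N\<^sup>4\<close> monomials in them with exponents below \<open>N\<close> have degree \<open>O(N)\<close>,
  whereas composed with \<open>segre\<close> a polynomial of degree \<open>d\<close> lies in the span of the
  at most \<open>(d + 1)\<^sup>3\<close> monomials \<open>s\<^sup>a v\<^sup>n\<^sup>-\<^sup>a t\<^sup>c u\<^sup>n\<^sup>-\<^sup>c\<close> with \<open>a, c \<le> n \<le> d\<close>
  (\<open>segre_coordinate_ring_growth\<close>, \<open>alg_indep_V_length_neq_4\<close>).

  Topology. With \<open>x = p + q\<close>, \<open>y = p - q\<close>, \<open>z = r + s\<close>, \<open>w = r - s\<close>, the equation \<open>xy = zw\<close>
  becomes \<open>p\<^sup>2 + s\<^sup>2 = q\<^sup>2 + r\<^sup>2\<close>, so \<open>V\<close> is homeomorphic to the set of pairs of complex numbers of equal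
  modulus. The map \<open>(\<alpha>, \<beta>, t) \<mapsto> (t / (1 - t)) (\<alpha>, \<beta>)\<close> from torus \<open>\<times> [0, 1)\<close> onto this set is
  proper, hence a quotient map, and it identifies the same points as the cone does
  (\<open>open_cone_torus_homeomorphic\<close>).
\<close>

section \<open>Polynomial maps and algebraic sets\<close>

lemma vector_4:
  "(vector [x, y, z, w] :: 'a::zero^4) $ 1 = x"
  "(vector [x, y, z, w] :: 'a::zero^4) $ 2 = y"
  "(vector [x, y, z, w] :: 'a::zero^4) $ 3 = z"
  "(vector [x, y, z, w] :: 'a::zero^4) $ 4 = w"
  unfolding vector_def by simp_all

lemma polynomial_function_linear_compose:
  assumes "bounded_linear h" "polynomial_function f"
  shows "polynomial_function (\<lambda>x. h (f x))"
  using polynomial_function_compose[OF assms(2) polynomial_function_bounded_linear[OF assms(1)]]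
  by (simp add: o_def)

lemma polynomial_function_nth:
  "polynomial_function f \<Longrightarrow> polynomial_function (\<lambda>x. f x $ i)"
  by (rule polynomial_function_linear_compose[OF bounded_linear_vec_nth])

lemma polynomial_function_fst:
  "polynomial_function f \<Longrightarrow> polynomial_function (\<lambda>x. fst (f x))"
  by (rule polynomial_function_linear_compose[OF bounded_linear_fst])

lemma polynomial_function_snd:
  "polynomial_function f \<Longrightarrow> polynomial_function (\<lambda>x. snd (f x))"
  by (rule polynomial_function_linear_compose[OF bounded_linear_snd])

lemma polynomial_function_times:
  fixes f g :: "'a::real_normed_vector \<Rightarrow> real"
  shows "polynomial_function f \<Longrightarrow> polynomial_function g \<Longrightarrow> polynomial_function (\<lambda>x. f x * g x)"
  using polynomial_function_mult[of f g] by simp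

lemma polynomial_function_Pair:
  fixes f :: "'a::real_normed_vector \<Rightarrow> 'b::real_normed_vector"
    and g :: "'a \<Rightarrow> 'c::real_normed_vector"
  assumes "polynomial_function f" "polynomial_function g"
  shows "polynomial_function (\<lambda>x. (f x, g x))"
proof -
  have "bounded_linear (\<lambda>y::'b. (y, 0::'c))" "bounded_linear (\<lambda>y::'c. (0::'b, y))"
    by (intro bounded_linear_Pair bounded_linear_ident bounded_linear_zero)+
  then have "polynomial_function (\<lambda>x. (f x, 0) + (0, g x))"
    using assms
    by (intro polynomial_function_add polynomial_function_linear_compose[where h = "\<lambda>y. (y, 0)"]
        polynomial_function_linear_compose[where h = "\<lambda>y. (0, y)"])
  then show ?thesis by simp
qed

lemma polynomial_function_vec:
  fixes f :: "'a::real_normed_vector \<Rightarrow> 'b::euclidean_space^'n"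
  assumes "\<And>i. polynomial_function (\<lambda>x. f x $ i)"
  shows "polynomial_function f"
proof -
  have axis: "bounded_linear (axis i :: 'b \<Rightarrow> 'b^'n)" for i
    by (subst linear_linear, rule linearI) (auto simp: vec_eq_iff axis_def)
  have "polynomial_function (\<lambda>x. \<Sum>i\<in>UNIV. axis i (f x $ i))"
    by (intro polynomial_function_sum polynomial_function_linear_compose[OF axis] assms) simp
  moreover have "(\<Sum>i\<in>UNIV. axis i (v $ i)) = v" for v :: "'b^'n"
    by (simp add: vec_eq_iff axis_def)
  ultimately show ?thesis by simp
qed

lemmas polynomial_function_intros =
  polynomial_function_nth polynomial_function_fst polynomial_function_snd
  polynomial_function_times polynomial_function_Pair polynomial_function_add
  polynomial_function_diff polynomial_function_const polynomial_function_id

lemma polynomial_function_vector4: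
  fixes f g h k :: "'a::real_normed_vector \<Rightarrow> real"
  assumes "polynomial_function f" "polynomial_function g" "polynomial_function h" "polynomial_function k"
  shows "polynomial_function (\<lambda>x. vector [f x, g x, h x, k x] :: real^4)"
proof (rule polynomial_function_vec)
  fix i :: 4
  show "polynomial_function (\<lambda>x. (vector [f x, g x, h x, k x] :: real^4) $ i)"
    using exhaust_4[of i] assms by (auto simp: vector_4)
qed

lemma algebraic_set_UNIV: "algebraic_set UNIV"
  unfolding algebraic_set_def by (rule exI[of _ "{}"]) auto

lemma algebraic_set_eq:
  assumes "polynomial_function p" "polynomial_function q"
  shows "algebraic_set {x. p x = (q x :: real)}"
  unfolding algebraic_set_def
  by (rule exI[of _ "{\<lambda>x. p x - q x}"])
    (use assms in \<open>auto simp: real_polynomial_function_eq intro: polynomial_function_diff\<close>)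

lemma algebraic_set_Int:
  assumes "algebraic_set S" "algebraic_set T"
  shows "algebraic_set (S \<inter> T)"
proof -
  obtain P Q where "\<forall>p\<in>P. real_polynomial_function p" "S = {x. \<forall>p\<in>P. p x = 0}"
    "\<forall>p\<in>Q. real_polynomial_function p" "T = {x. \<forall>p\<in>Q. p x = 0}"
    using assms unfolding algebraic_set_def by blast
  then show ?thesis
    unfolding algebraic_set_def by (intro exI[of _ "P \<union> Q"]) blast
qed

lemma algebraic_set_conj:
  "algebraic_set {x. P x} \<Longrightarrow> algebraic_set {x. Q x} \<Longrightarrow> algebraic_set {x. P x \<and> Q x}"
  using algebraic_set_Int[of "{x. P x}" "{x. Q x}"] by (simp add: Int_def)

lemma algebraic_set_vimage:
  assumes "polynomial_function f" "algebraic_set S"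
  shows "algebraic_set (f -` S)"
proof -
  obtain P where P: "\<forall>p\<in>P. real_polynomial_function p" "S = {x. \<forall>p\<in>P. p x = 0}"
    using assms(2) unfolding algebraic_set_def by blast
  show ?thesis unfolding algebraic_set_def
    by (rule exI[of _ "(\<lambda>p. p \<circ> f) ` P"])
      (use P assms(1) in \<open>auto intro: real_polynomial_function_compose\<close>)
qed

lemma isomorphic_varieties_homeomorphic:
  assumes "isomorphic_varieties S T"
  shows "top_of_set S homeomorphic_space top_of_set T"
proof -
  obtain f g where f: "polynomial_function f" and g: "polynomial_function g"
    and bij: "bij_betw f S T" and gf: "\<forall>x\<in>S. g (f x) = x"
    using assms unfolding isomorphic_varieties_def by blast
  have im: "f ` S = T" using bij by (rule bij_betw_imp_surj_on)
  with gf have "g ` T = S" "\<forall>y\<in>T. f (g y) = y" by force+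
  then have "homeomorphic_maps (top_of_set S) (top_of_set T) f g"
    unfolding homeomorphic_maps_def continuous_map_in_subtopology
    using gf im f g by (auto simp: continuous_on_polymonial_function)
  then show ?thesis by (auto simp: homeomorphic_space_def)
qed

section \<open>The isomorphism\<close>

lemma algebraic_set_Heis0: "algebraic_set (carrier Heis0)"
proof -
  have "carrier Heis0 = {M. M $ 1 $ 1 = 1 \<and> M $ 2 $ 1 = 0 \<and> M $ 2 $ 2 = 1 \<and>
      M $ 3 $ 1 = 0 \<and> M $ 3 $ 2 = 0 \<and> M $ 3 $ 3 = 1}" (is "_ = ?R")
  proof
    show "carrier Heis0 \<subseteq> ?R" by (auto simp: Heis0_def heis_mat_def)
    show "?R \<subseteq> carrier Heis0"
    proof
      fix M assume "M \<in> ?R"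
      then have "M = heis_mat (M $ 1 $ 2) (M $ 2 $ 3) (M $ 1 $ 3)"
        by (simp add: heis_mat_def vec_eq_iff forall_3)
      then show "M \<in> carrier Heis0" by (auto simp: Heis0_def)
    qed
  qed
  then show ?thesis
    by (simp only:) (intro algebraic_set_conj algebraic_set_eq polynomial_function_intros)
qed

lemma heis_mat_eq_iff: "heis_mat a b c = heis_mat a' b' c' \<longleftrightarrow> a = a' \<and> b = b' \<and> c = c'"
  by (auto simp: heis_mat_def vec_eq_iff forall_3)

lemma heis_mat_nth:
  "heis_mat a b c $ 1 $ 2 = a" "heis_mat a b c $ 2 $ 3 = b" "heis_mat a b c $ 1 $ 3 = c"
  by (simp_all add: heis_mat_def)

lemma heis_mat_commute_iff:
  "heis_mat a b c ** heis_mat a' b' c' = heis_mat a' b' c' ** heis_mat a b c \<longleftrightarrow> a * b' = a' * b"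
  by (auto simp: heis_mat_mult heis_mat_eq_iff algebra_simps)

lemma Hom_Z2_Heis0_coords:
  "Hom_Z2_Heis0 = {(heis_mat a b c, heis_mat a' b' c') | a b c a' b' c'. a * b' = a' * b}"
  unfolding Hom_Z2_Heis0_eq Heis0_def
  by (auto simp: heis_mat_commute_iff heis_mat_eq_iff)

lemma algebraic_set_Hom: "algebraic_set Hom_Z2_Heis0"
proof -
  have eq: "Hom_Z2_Heis0 = (fst -` carrier Heis0 \<inter> snd -` carrier Heis0) \<inter>
      {z. fst z $ 1 $ 2 * snd z $ 2 $ 3 = snd z $ 1 $ 2 * fst z $ 2 $ 3}"
    unfolding Hom_Z2_Heis0_coords Heis0_def
    by (auto simp: heis_mat_nth heis_mat_eq_iff)
  show ?thesis unfolding eq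
    by (intro algebraic_set_Int algebraic_set_vimage algebraic_set_eq algebraic_set_Heis0
        polynomial_function_intros)
qed

lemma algebraic_set_V: "algebraic_set V"
  unfolding V_def by (intro algebraic_set_eq polynomial_function_intros)

lemma Hom_isomorphic_V_times_plane:
  "isomorphic_varieties Hom_Z2_Heis0 (V \<times> (UNIV :: (real^2) set))"
proof -
  define f :: "(real^3^3) \<times> (real^3^3) \<Rightarrow> (real^4) \<times> (real^2)" where
    "f = (\<lambda>z. (vector [fst z $ 1 $ 2, snd z $ 2 $ 3, snd z $ 1 $ 2, fst z $ 2 $ 3],
               vector [fst z $ 1 $ 3, snd z $ 1 $ 3]))"
  define g :: "(real^4) \<times> (real^2) \<Rightarrow> (real^3^3) \<times> (real^3^3)" where
    "g = (\<lambda>z. (heis_mat (fst z $ 1) (fst z $ 4) (snd z $ 1),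
               heis_mat (fst z $ 3) (fst z $ 2) (snd z $ 2)))"
  have vec2: "polynomial_function (\<lambda>z. vector [p z, q z] :: real^2)"
    if "polynomial_function p" "polynomial_function q"
    for p q :: "(real^3^3) \<times> (real^3^3) \<Rightarrow> real"
  proof (rule polynomial_function_vec)
    fix i :: 2
    show "polynomial_function (\<lambda>z. (vector [p z, q z] :: real^2) $ i)"
      using exhaust_2[of i] that by auto
  qed
  have vec3: "polynomial_function (\<lambda>z. vector [p z, q z, r z] :: 'b^3)"
    if "polynomial_function p" "polynomial_function q" "polynomial_function r"
    for p q r :: "(real^4) \<times> (real^2) \<Rightarrow> 'b::euclidean_space"
  proof (rule polynomial_function_vec)
    fix i :: 3
    show "polynomial_function (\<lambda>z. (vector [p z, q z, r z] :: 'b^3) $ i)"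
      using exhaust_3[of i] that by auto
  qed
  have f: "polynomial_function f"
    unfolding f_def by (intro polynomial_function_intros vec2 polynomial_function_vector4)
  have g: "polynomial_function g"
    unfolding g_def heis_mat_def by (intro polynomial_function_intros vec3)
  have gf: "g (f z) = z" if "z \<in> Hom_Z2_Heis0" for z
    using that unfolding Hom_Z2_Heis0_coords f_def g_def
    by (auto simp: heis_mat_nth vector_4)
  have fg: "f (g y) = y" for y
    unfolding f_def g_def
    by (cases y) (auto simp: heis_mat_nth vec_eq_iff forall_4 forall_2 vector_4)
  have fV: "f z \<in> V \<times> UNIV" if "z \<in> Hom_Z2_Heis0" for z
    using that unfolding Hom_Z2_Heis0_coords f_def V_def
    by (auto simp: heis_mat_nth vector_4)
  have gV: "g y \<in> Hom_Z2_Heis0" if "y \<in> V \<times> UNIV" for y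
    using that unfolding Hom_Z2_Heis0_coords g_def V_def by (auto simp: heis_mat_eq_iff)
  have "bij_betw f Hom_Z2_Heis0 (V \<times> UNIV)"
    by (rule bij_betw_byWitness[where f' = g]) (use gf fg fV gV in blast)+
  moreover have "algebraic_set (V \<times> (UNIV :: (real^2) set))"
    using algebraic_set_vimage[OF polynomial_function_fst[OF polynomial_function_id] algebraic_set_V]
    by (simp add: vimage_fst)
  ultimately show ?thesis
    unfolding isomorphic_varieties_def using algebraic_set_Hom f g gf by blast
qed

section \<open>Irreducible sets\<close>

lemma real_polynomial_function_finite_roots:
  fixes p :: "real \<Rightarrow> real"
  assumes "real_polynomial_function p" "p t \<noteq> 0"
  shows "finite {x. p x = 0}"
proof -
  obtain a n where p: "p = (\<lambda>x. \<Sum>i\<le>n. a i * x ^ i)"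
    using real_polynomial_function_imp_sum[OF assms(1)] by blast
  with assms(2) have "\<exists>i\<le>n. a i \<noteq> 0" by (auto intro: ccontr)
  then show ?thesis unfolding p polyfun_finite_roots by blast
qed

text \<open>The proof restricts two polynomials, neither of which is zero, to a line through a point
  where the first one does not vanish and a point where the second one does not.\<close>

lemma irreducible_variety_UNIV: "irreducible_variety (UNIV :: 'a::euclidean_space set)"
  unfolding irreducible_variety_def
proof (intro conjI allI impI algebraic_set_UNIV UNIV_not_empty)
  fix A B :: "'a set"
  assume AB: "algebraic_set A \<and> algebraic_set B \<and> UNIV = A \<union> B"
  show "A = UNIV \<or> B = UNIV"
  proof (rule ccontr)
    assume "\<not> (A = UNIV \<or> B = UNIV)"
    then obtain x y where "x \<notin> A" "y \<notin> B" by blast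
    have separate: "\<exists>p. real_polynomial_function p \<and> p u \<noteq> 0 \<and> (\<forall>a\<in>S. p a = 0)"
      if "algebraic_set S" "u \<notin> S" for S and u :: 'a
      using that unfolding algebraic_set_def by blast
    obtain p where p: "real_polynomial_function p" "p x \<noteq> 0" "\<forall>a\<in>A. p a = 0"
      using separate[OF _ \<open>x \<notin> A\<close>] AB by blast
    obtain q where q: "real_polynomial_function q" "q y \<noteq> 0" "\<forall>b\<in>B. q b = 0"
      using separate[OF _ \<open>y \<notin> B\<close>] AB by blast
    define l where "l = (\<lambda>t::real. x + t *\<^sub>R (y - x))"
    have l: "polynomial_function l"
      unfolding l_def by (intro polynomial_function_add polynomial_function_mult
          polynomial_function_id polynomial_function_const)
    have "finite {t. (p \<circ> l) t = 0}"
      by (rule real_polynomial_function_finite_roots[where t = 0, OF real_polynomial_function_compose[OF l p(1)]])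
        (simp add: l_def p(2))
    moreover have "finite {t. (q \<circ> l) t = 0}"
      by (rule real_polynomial_function_finite_roots[where t = 1, OF real_polynomial_function_compose[OF l q(1)]])
        (simp add: l_def q(2))
    moreover have "UNIV = {t. (p \<circ> l) t = 0} \<union> {t. (q \<circ> l) t = 0}"
      using AB p(3) q(3) by fastforce
    ultimately show False
      using infinite_UNIV_char_0[where 'a = real] by (metis finite_UnI)
  qed
qed

lemma irreducible_variety_range:
  fixes f :: "'a::euclidean_space \<Rightarrow> 'b::euclidean_space"
  assumes f: "polynomial_function f" and alg: "algebraic_set (range f)"
  shows "irreducible_variety (range f)"
  unfolding irreducible_variety_def
proof (intro conjI allI impI alg)
  show "range f \<noteq> {}" by simp
  fix A B assume AB: "algebraic_set A \<and> algebraic_set B \<and> range f = A \<union> B"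
  have "UNIV = f -` A \<union> f -` B" using AB by (auto simp flip: vimage_Un)
  moreover have "algebraic_set (f -` A)" "algebraic_set (f -` B)"
    using AB algebraic_set_vimage[OF f] by simp_all
  ultimately have "f -` A = UNIV \<or> f -` B = UNIV"
    using irreducible_variety_UNIV[where 'a = 'a] unfolding irreducible_variety_def by metis
  then have "range f \<subseteq> A \<or> range f \<subseteq> B" by blast
  then show "A = range f \<or> B = range f" using AB by blast
qed

lemma irreducible_variety_zero_product:
  assumes Z: "irreducible_variety Z"
    and p: "real_polynomial_function p" and q: "real_polynomial_function q"
    and pq: "\<forall>x\<in>Z. p x * q x = 0"
  shows "(\<forall>x\<in>Z. p x = 0) \<or> (\<forall>x\<in>Z. q x = 0)"
proof -
  have alg: "algebraic_set (Z \<inter> {x. r x = 0})" if "real_polynomial_function r" for r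
    using Z that unfolding irreducible_variety_def
    by (intro algebraic_set_Int algebraic_set_eq) (auto simp: real_polynomial_function_eq)
  have "Z = (Z \<inter> {x. p x = 0}) \<union> (Z \<inter> {x. q x = 0})" using pq by auto
  then have "Z \<inter> {x. p x = 0} = Z \<or> Z \<inter> {x. q x = 0} = Z"
    using Z alg[OF p] alg[OF q] unfolding irreducible_variety_def by blast
  then show ?thesis by blast
qed

section \<open>Algebraic independence along chains\<close>

text \<open>Exponent vectors of length \<open>k\<close> with all entries below \<open>N\<close>.\<close>

definition exponents :: "nat \<Rightarrow> nat \<Rightarrow> nat list set" where
  "exponents N k = {\<alpha>. set \<alpha> \<subseteq> {..<N} \<and> length \<alpha> = k}"

text \<open>The monomial with exponent vector \<open>\<alpha>\<close> in the functions \<open>fs\<close>, as a function.\<close>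

definition monomial :: "('a \<Rightarrow> real) list \<Rightarrow> nat list \<Rightarrow> 'a \<Rightarrow> real" where
  "monomial fs \<alpha> x = prod_list (map2 (\<lambda>f a. f x ^ a) fs \<alpha>)"

text \<open>Algebraic independence over \<open>\<real>\<close> of the restrictions to \<open>Z\<close>: no nontrivial linear
  combination of monomials vanishes on \<open>Z\<close>. Finitely many monomials always have all their exponents
  below some \<open>N\<close>. The empty family is independent on \<open>Z\<close> if and only if \<open>Z\<close> is nonempty.\<close>

definition alg_indep :: "'a set \<Rightarrow> ('a \<Rightarrow> real) list \<Rightarrow> bool" where
  "alg_indep Z fs \<longleftrightarrow>
     (\<forall>N c. (\<forall>x\<in>Z. (\<Sum>\<alpha>\<in>exponents N (length fs). c \<alpha> * monomial fs \<alpha> x) = 0) \<longrightarrow>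
            (\<forall>\<alpha>\<in>exponents N (length fs). c \<alpha> = 0))"

lemma finite_exponents [simp]: "finite (exponents N k)"
  unfolding exponents_def by (rule finite_lists_length_eq) simp

lemma card_exponents: "card (exponents N k) = N ^ k"
  unfolding exponents_def by (simp add: card_lists_length_eq)

lemma exponents_0 [simp]: "exponents N 0 = {[]}"
  by (auto simp: exponents_def)

lemma exponents_Suc: "exponents N (Suc k) = (\<lambda>(a, \<alpha>). a # \<alpha>) ` ({..<N} \<times> exponents N k)"
  by (auto simp: exponents_def image_iff length_Suc_conv)

lemma sum_exponents_Suc:
  "(\<Sum>\<alpha>\<in>exponents N (Suc k). F \<alpha>) = (\<Sum>a<N. \<Sum>\<alpha>\<in>exponents N k. F (a # \<alpha>))"
proof -
  have "inj_on (\<lambda>(a, \<alpha>). a # \<alpha>) ({..<N} \<times> exponents N k)" by (auto simp: inj_on_def)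
  then show ?thesis
    unfolding exponents_Suc by (simp add: sum.reindex sum.cartesian_product split_def)
qed

lemma monomial_Nil [simp]: "monomial [] \<alpha> x = 1"
  by (simp add: monomial_def)

lemma monomial_Cons [simp]: "monomial (f # fs) (a # \<alpha>) x = f x ^ a * monomial fs \<alpha> x"
  by (simp add: monomial_def)

lemma real_polynomial_function_monomial:
  assumes "\<forall>f\<in>set fs. real_polynomial_function f"
  shows "real_polynomial_function (monomial fs \<alpha>)"
  using assms
proof (induction fs arbitrary: \<alpha>)
  case Nil
  show ?case using real_polynomial_function.intros(2)[of 1] by (simp add: monomial_def[abs_def])
next
  case (Cons f fs)
  show ?case
  proof (cases \<alpha>)
    case Nil
    then show ?thesis using real_polynomial_function.intros(2)[of 1] by (simp add: monomial_def[abs_def])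
  next
    case (Cons a \<beta>)
    have "real_polynomial_function (\<lambda>x. f x ^ a * monomial fs \<beta> x)"
      using Cons.IH[of \<beta>] Cons.prems
      by (intro real_polynomial_function.intros(4) real_polynomial_function_power) auto
    moreover have "monomial (f # fs) \<alpha> = (\<lambda>x. f x ^ a * monomial fs \<beta> x)"
      using Cons by auto
    ultimately show ?thesis by (simp only:)
  qed
qed

text \<open>A relation \<open>\<Sum>\<^sub>a h\<^sup>a g\<^sub>a = 0\<close> on \<open>Z'\<close>, with each \<open>g\<^sub>a\<close> a combination of monomials in \<open>fs\<close>, can be
  divided by the lowest power of \<open>h\<close> that occurs, since \<open>Z'\<close> is irreducible. Restricting the quotient
  to \<open>Z\<close>, where \<open>h = 0\<close>, leaves a relation between the \<open>fs\<close>.\<close>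

lemma alg_indep_Cons:
  fixes Z Z' :: "'a::euclidean_space set"
  assumes irr: "irreducible_variety Z'" and sub: "Z \<subseteq> Z'"
    and fs: "\<forall>f\<in>set fs. real_polynomial_function f"
    and h: "real_polynomial_function h" "\<forall>x\<in>Z. h x = 0" "\<exists>x\<in>Z'. h x \<noteq> 0"
    and ind: "alg_indep Z fs"
  shows "alg_indep Z' (h # fs)"
  unfolding alg_indep_def
proof (intro allI impI)
  fix N c
  assume rel: "\<forall>x\<in>Z'. (\<Sum>\<alpha>\<in>exponents N (length (h # fs)). c \<alpha> * monomial (h # fs) \<alpha> x) = 0"
  define g where "g a x = (\<Sum>\<alpha>\<in>exponents N (length fs). c (a # \<alpha>) * monomial fs \<alpha> x)" for a x
  have g_poly: "real_polynomial_function (g a)" for a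
    unfolding g_def
    by (intro real_polynomial_function_sum real_polynomial_function.intros(4)
        real_polynomial_function.intros(2) real_polynomial_function_monomial fs finite_exponents)
  have sum0: "(\<Sum>a<N. h x ^ a * g a x) = 0" if "x \<in> Z'" for x
    using rel that unfolding g_def
    by (simp add: sum_exponents_Suc sum_distrib_left mult_ac)
  have coeffs: "\<forall>\<alpha>\<in>exponents N (length fs). c (a # \<alpha>) = 0" if "a < N" for a
    using that
  proof (induction a rule: less_induct)
    case (less a)
    \<comment> \<open>The quotient of the relation by \<open>h\<^sup>a\<close>; by the induction hypothesis no lower powers occur.\<close>
    define r where "r x = g a x + (\<Sum>b\<in>{a<..<N}. h x ^ (b - a) * g b x)" for x
    have "real_polynomial_function r"
      unfolding r_def
      by (intro real_polynomial_function_sum real_polynomial_function.intros(4)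
          real_polynomial_function.intros(3) real_polynomial_function_power g_poly h) simp
    moreover have "real_polynomial_function (\<lambda>x. h x ^ a)"
      by (intro real_polynomial_function_power h)
    moreover have "h x ^ a * r x = 0" if "x \<in> Z'" for x
    proof -
      have low: "g b x = 0" if "b < a" for b
        using less.IH[OF that] that less.prems by (simp add: g_def)
      have split: "{..<N} = {..<a} \<union> insert a {a<..<N}" using less.prems by auto
      have "(\<Sum>b<N. h x ^ b * g b x)
          = (\<Sum>b<a. h x ^ b * g b x) + (\<Sum>b\<in>insert a {a<..<N}. h x ^ b * g b x)"
        unfolding split by (rule sum.union_disjoint) auto
      also have "(\<Sum>b<a. h x ^ b * g b x) = 0"
        using low by (intro sum.neutral) auto
      also have "(\<Sum>b\<in>insert a {a<..<N}. h x ^ b * g b x)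
          = h x ^ a * g a x + (\<Sum>b\<in>{a<..<N}. h x ^ b * g b x)"
        by (rule sum.insert) auto
      also have "(\<Sum>b\<in>{a<..<N}. h x ^ b * g b x)
          = h x ^ a * (\<Sum>b\<in>{a<..<N}. h x ^ (b - a) * g b x)"
        unfolding sum_distrib_left
      proof (rule sum.cong)
        fix b assume "b \<in> {a<..<N}"
        then have "h x ^ b = h x ^ a * h x ^ (b - a)"
          by (simp flip: power_add)
        then show "h x ^ b * g b x = h x ^ a * (h x ^ (b - a) * g b x)"
          by (simp only: mult.assoc)
      qed simp
      finally show ?thesis
        using sum0[OF that] by (simp add: r_def distrib_left)
    qed
    ultimately have "(\<forall>x\<in>Z'. h x ^ a = 0) \<or> (\<forall>x\<in>Z'. r x = 0)"
      using irreducible_variety_zero_product[OF irr, of "\<lambda>x. h x ^ a" r] by blast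
    then have "\<forall>x\<in>Z'. r x = 0" using h(3) by auto
    moreover have "r x = g a x" if "x \<in> Z" for x
      using h(2) that by (auto simp: r_def intro!: sum.neutral)
    ultimately have "\<forall>x\<in>Z. g a x = 0" using sub by (metis subsetD)
    then show ?case using ind unfolding alg_indep_def g_def
      by (elim allE[of _ N] allE[of _ "\<lambda>\<alpha>. c (a # \<alpha>)"]) simp
  qed
  show "\<forall>\<alpha>\<in>exponents N (length (h # fs)). c \<alpha> = 0"
    using coeffs by (auto simp: exponents_Suc)
qed

lemma chain_alg_indep:
  fixes Z :: "nat \<Rightarrow> 'a::euclidean_space set"
  assumes "\<forall>i\<le>n. irreducible_variety (Z i)" "\<forall>i<n. Z i \<subset> Z (Suc i)"
  shows "\<exists>fs. length fs = n \<and> (\<forall>f\<in>set fs. real_polynomial_function f) \<and> alg_indep (Z n) fs"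
  using assms
proof (induction n)
  case 0
  then have "Z 0 \<noteq> {}" by (simp add: irreducible_variety_def)
  then have "alg_indep (Z 0) []" by (auto simp: alg_indep_def)
  then show ?case by auto
next
  case (Suc n)
  then obtain fs where fs: "length fs = n" "\<forall>f\<in>set fs. real_polynomial_function f"
      "alg_indep (Z n) fs" by auto
  have sub: "Z n \<subset> Z (Suc n)" and irr: "irreducible_variety (Z (Suc n))"
    using Suc.prems by auto
  obtain x where x: "x \<in> Z (Suc n)" "x \<notin> Z n" using sub by blast
  have "algebraic_set (Z n)" using Suc.prems by (simp add: irreducible_variety_def)
  with x(2) obtain h where h: "real_polynomial_function h" "\<forall>y\<in>Z n. h y = 0" "h x \<noteq> 0"
    unfolding algebraic_set_def by blast
  then have "alg_indep (Z (Suc n)) (h # fs)"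
    using alg_indep_Cons[OF irr _ fs(2) h(1,2) _ fs(3)] sub x(1) by blast
  with fs h(1) show ?case by (intro exI[of _ "h # fs"]) auto
qed

lemma alg_indep_mono: "alg_indep Z fs \<Longrightarrow> Z \<subseteq> Z' \<Longrightarrow> alg_indep Z' fs"
  unfolding alg_indep_def by blast

lemma homogeneous_system_nontrivial_solution:
  fixes M :: "'a \<Rightarrow> 'b \<Rightarrow> 'f::field"
  assumes "finite B" "finite A" "card B < card A"
  shows "\<exists>c. (\<exists>a\<in>A. c a \<noteq> 0) \<and> (\<forall>b\<in>B. (\<Sum>a\<in>A. c a * M a b) = 0)"
  using assms
proof (induction B arbitrary: A M rule: finite_induct)
  case empty
  then have "A \<noteq> {}" by auto
  then show ?case by (intro exI[of _ "\<lambda>_. 1"]) auto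
next
  case (insert b B)
  show ?case
  proof (cases "\<forall>a\<in>A. M a b = 0")
    case True
    have "card B < card A" using insert.prems insert.hyps by simp
    from insert.IH[OF insert.prems(1) this, of M] True show ?thesis by auto
  next
    case False
    then obtain a0 where a0: "a0 \<in> A" "M a0 b \<noteq> 0" by blast
    \<comment> \<open>Solve equation \<open>b\<close> for the unknown \<open>a0\<close> and substitute.\<close>
    define M' where "M' a b' = M a b' - M a b / M a0 b * M a0 b'" for a b'
    have "card B < card (A - {a0})" using insert.prems insert.hyps a0 by simp
    from insert.IH[OF _ this, of M'] insert.prems obtain c where
      c: "\<exists>a\<in>A - {a0}. c a \<noteq> 0" "\<forall>b'\<in>B. (\<Sum>a\<in>A - {a0}. c a * M' a b') = 0" by auto
    define c' where "c' = c(a0 := - (\<Sum>a\<in>A - {a0}. c a * M a b / M a0 b))"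
    have sum_c': "(\<Sum>a\<in>A. c' a * M a b') = (\<Sum>a\<in>A - {a0}. c a * M' a b')" for b'
    proof -
      have "(\<Sum>a\<in>A. c' a * M a b') = c' a0 * M a0 b' + (\<Sum>a\<in>A - {a0}. c' a * M a b')"
        using insert.prems a0 by (simp add: sum.remove)
      also have "(\<Sum>a\<in>A - {a0}. c' a * M a b') = (\<Sum>a\<in>A - {a0}. c a * M a b')"
        by (rule sum.cong) (auto simp: c'_def)
      moreover have "(\<Sum>a\<in>A - {a0}. c a * M' a b')
          = (\<Sum>a\<in>A - {a0}. c a * M a b') - (\<Sum>a\<in>A - {a0}. c a * M a b / M a0 b) * M a0 b'"
        by (simp add: M'_def right_diff_distrib sum_subtractf sum_distrib_left mult_ac)
      ultimately show ?thesis by (simp add: c'_def)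
    qed
    have "(\<Sum>a\<in>A. c' a * M a b') = 0" if "b' \<in> insert b B" for b'
    proof (cases "b' = b")
      case True
      have "M' a b = 0" for a using a0 by (simp add: M'_def)
      then show ?thesis unfolding sum_c' True by simp
    next
      case False
      then show ?thesis unfolding sum_c' using that c(2) by blast
    qed
    moreover have "\<exists>a\<in>A. c' a \<noteq> 0" using c(1) by (auto simp: c'_def)
    ultimately show ?thesis by blast
  qed
qed

section \<open>The dimension of the quadric cone\<close>

text \<open>The parametrization of the \<open>2 \<times> 2\<close> matrices of rank at most one, with entries \<open>x, z; w, y\<close>, as
  products of a column \<open>(s, v)\<close> and a row \<open>(t, u)\<close>; the parameter is the vector \<open>(s, v, t, u)\<close>.\<close>

definition segre :: "real^4 \<Rightarrow> real^4" where
  "segre p = vector [p $ 1 * p $ 3, p $ 2 * p $ 4, p $ 1 * p $ 4, p $ 2 * p $ 3]"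

lemma range_segre: "range segre = V"
proof
  show "range segre \<subseteq> V" by (auto simp: segre_def V_def vector_4)
  show "V \<subseteq> range segre"
  proof
    fix p assume "p \<in> V"
    then have p: "p $ 1 * p $ 2 = p $ 3 * p $ 4" by (simp add: V_def)
    have in_range: "p \<in> range segre" if "p $ 1 = s * t" "p $ 2 = v * u" "p $ 3 = s * u" "p $ 4 = v * t"
      for s v t u
      by (rule range_eqI[of _ _ "vector [s, v, t, u]"])
        (use that in \<open>simp add: segre_def vec_eq_iff forall_4 vector_4\<close>)
    show "p \<in> range segre"
    proof (cases "p $ 1 = 0")
      case False
      with p show ?thesis by (intro in_range[of "p $ 1" 1 "p $ 4" "p $ 3 / p $ 1"]) (auto simp: field_simps)
    next
      case True
      with p consider "p $ 3 = 0" | "p $ 4 = 0" by auto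
      then show ?thesis
      proof cases
        case 1
        with True show ?thesis by (intro in_range[of 0 "p $ 4" 1 "p $ 2"]) auto
      next
        case 2
        with True show ?thesis by (intro in_range[of "p $ 3" 0 "p $ 2" 1]) auto
      qed
    qed
  qed
qed

lemma irreducible_variety_V: "irreducible_variety V"
  unfolding range_segre[symmetric]
proof (rule irreducible_variety_range)
  show "polynomial_function segre"
    unfolding segre_def by (intro polynomial_function_vector4 polynomial_function_intros)
  show "algebraic_set (range segre)"
    by (simp add: range_segre algebraic_set_V)
qed

lemma variety_dim_V_ge: "3 \<le> variety_dim V"
proof -
  define L1 L2 :: "(real^4) set"
    where "L1 = {x. x $ 2 = 0 \<and> x $ 3 = 0 \<and> x $ 4 = 0}" and "L2 = {x. x $ 2 = 0 \<and> x $ 3 = 0}"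
  define Z where "Z = (\<lambda>i::nat. [{0}, L1, L2, V] ! i)"
  have irr: "irreducible_variety S" if "S = range f" "polynomial_function f" "algebraic_set S"
    for S and f :: "real^4 \<Rightarrow> real^4"
    using irreducible_variety_range[of f] that by simp
  have "irreducible_variety ({0} :: (real^4) set)"
  proof (rule irr[of _ "\<lambda>_. 0"])
    have "algebraic_set {x :: real^4. x $ 1 = 0 \<and> x $ 2 = 0 \<and> x $ 3 = 0 \<and> x $ 4 = 0}"
      by (intro algebraic_set_conj algebraic_set_eq polynomial_function_intros)
    also have "{x :: real^4. x $ 1 = 0 \<and> x $ 2 = 0 \<and> x $ 3 = 0 \<and> x $ 4 = 0} = {0}"
      by (auto simp: vec_eq_iff forall_4)
    finally show "algebraic_set ({0} :: (real^4) set)" .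
  qed auto
  moreover have "irreducible_variety L1"
  proof (rule irr[of _ "\<lambda>x. vector [x $ 1, 0, 0, 0]"])
    show "L1 = range (\<lambda>x :: real^4. vector [x $ 1, 0, 0, 0])"
      unfolding L1_def image_def by (auto simp: vec_eq_iff forall_4 vector_4)
    show "algebraic_set L1"
      unfolding L1_def by (intro algebraic_set_conj algebraic_set_eq polynomial_function_intros)
  qed (intro polynomial_function_vector4 polynomial_function_intros)
  moreover have "irreducible_variety L2"
  proof (rule irr[of _ "\<lambda>x. vector [x $ 1, 0, 0, x $ 4]"])
    show "L2 = range (\<lambda>x :: real^4. vector [x $ 1, 0, 0, x $ 4])"
      unfolding L2_def image_def by (auto simp: vec_eq_iff forall_4 vector_4)
    show "algebraic_set L2"
      unfolding L2_def by (intro algebraic_set_conj algebraic_set_eq polynomial_function_intros)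
  qed (intro polynomial_function_vector4 polynomial_function_intros)
  moreover have "{0} \<subset> L1"
  proof -
    have "vector [1, 0, 0, 0] \<in> L1" "vector [1, 0, 0, 0] \<notin> {0 :: real^4}"
      by (auto simp: L1_def vec_eq_iff vector_4 intro!: exI[of _ 1])
    then show ?thesis by (auto simp: L1_def)
  qed
  moreover have "L1 \<subset> L2"
  proof -
    have "vector [0, 0, 0, 1] \<in> L2" "vector [0, 0, 0, 1] \<notin> L1"
      by (auto simp: L1_def L2_def vector_4)
    then show ?thesis by (auto simp: L1_def L2_def)
  qed
  moreover have "L2 \<subset> V"
  proof -
    have "vector [0, 1, 0, 0] \<in> V" "vector [0, 1, 0, 0] \<notin> L2"
      by (auto simp: V_def L2_def vector_4)
    then show ?thesis by (auto simp: V_def L2_def)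
  qed
  moreover note irreducible_variety_V
  ultimately have "(\<forall>i\<le>3. irreducible_variety (Z i) \<and> Z i \<subseteq> V) \<and> (\<forall>i<3. Z i \<subset> Z (Suc i))"
    unfolding Z_def by (auto simp: numeral_3_eq_3 le_Suc_eq less_Suc_eq)
  then have "enat 3 \<le> variety_dim V"
    unfolding variety_dim_def by (intro Sup_upper) blast
  then show ?thesis by (simp add: numeral_eq_enat)
qed

text \<open>The monomials \<open>s\<^sup>a v\<^sup>n\<^sup>-\<^sup>a t\<^sup>c u\<^sup>n\<^sup>-\<^sup>c\<close> of bidegree \<open>(n, n)\<close>, indexed by \<open>(n, a, c)\<close>, and the index set of
  those with \<open>n \<le> d\<close>.\<close>

definition bimonomial :: "nat \<times> nat \<times> nat \<Rightarrow> real^4 \<Rightarrow> real" where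
  "bimonomial = (\<lambda>(n, a, c) p. p $ 1 ^ a * p $ 2 ^ (n - a) * p $ 3 ^ c * p $ 4 ^ (n - c))"

definition bi_indices :: "nat \<Rightarrow> (nat \<times> nat \<times> nat) set" where
  "bi_indices d = {(n, a, c). n \<le> d \<and> a \<le> n \<and> c \<le> n}"

text \<open>The span of these monomials. It contains \<open>q \<circ> segre\<close> for every polynomial \<open>q\<close> of degree at most
  \<open>d\<close>.\<close>

definition bi_span :: "nat \<Rightarrow> (real^4 \<Rightarrow> real) \<Rightarrow> bool" where
  "bi_span d f \<longleftrightarrow> (\<exists>C. f = (\<lambda>p. \<Sum>i\<in>bi_indices d. C i * bimonomial i p))"

lemma finite_bi_indices [simp]: "finite (bi_indices d)"
  by (rule finite_subset[of _ "{..d} \<times> {..d} \<times> {..d}"]) (auto simp: bi_indices_def)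

lemma card_bi_indices_le: "card (bi_indices d) \<le> (d + 1) ^ 3"
proof -
  have "card (bi_indices d) \<le> card ({..d} \<times> {..d} \<times> {..d})"
    by (rule card_mono) (auto simp: bi_indices_def)
  also have "\<dots> = (d + 1) ^ 3" by (simp add: card_cartesian_product power3_eq_cube)
  finally show ?thesis .
qed

lemma bi_span_basis:
  assumes "i \<in> bi_indices d"
  shows "bi_span d (bimonomial i)"
  unfolding bi_span_def
proof (intro exI ext)
  fix p
  show "bimonomial i p = (\<Sum>j\<in>bi_indices d. (if j = i then 1 else 0) * bimonomial j p)"
    using assms by (simp add: if_distrib[of "\<lambda>x. x * _"] cong: if_cong)
qed

lemma bi_span_add: "bi_span d f \<Longrightarrow> bi_span d g \<Longrightarrow> bi_span d (\<lambda>p. f p + g p)"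
  unfolding bi_span_def
  by (elim exE, rule_tac x = "\<lambda>i. C i + Ca i" in exI) (simp add: distrib_right sum.distrib)

lemma bi_span_scale: "bi_span d f \<Longrightarrow> bi_span d (\<lambda>p. r * f p)"
  unfolding bi_span_def
  by (elim exE, rule_tac x = "\<lambda>i. r * C i" in exI) (simp add: sum_distrib_left mult.assoc)

lemma bi_span_sum:
  assumes "finite I" "\<And>i. i \<in> I \<Longrightarrow> bi_span d (f i)"
  shows "bi_span d (\<lambda>p. \<Sum>i\<in>I. f i p)"
  using assms
proof (induction I rule: finite_induct)
  case empty
  show ?case unfolding bi_span_def by (rule exI[of _ "\<lambda>_. 0"]) simp
next
  case (insert i I)
  then show ?case by (simp add: bi_span_add)
qed

lemma bi_span_mult:
  assumes "bi_span d f" "bi_span e g"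
  shows "bi_span (d + e) (\<lambda>p. f p * g p)"
proof -
  obtain C D where f: "f = (\<lambda>p. \<Sum>i\<in>bi_indices d. C i * bimonomial i p)"
    and g: "g = (\<lambda>p. \<Sum>j\<in>bi_indices e. D j * bimonomial j p)"
    using assms unfolding bi_span_def by blast
  have prod: "bi_span (d + e) (\<lambda>p. bimonomial i p * bimonomial j p)"
    if "i \<in> bi_indices d" "j \<in> bi_indices e" for i j
  proof -
    obtain n a c m a' c' where ij: "i = (n, a, c)" "j = (m, a', c')"
      by (metis prod_cases3)
    then have le: "n \<le> d" "a \<le> n" "c \<le> n" "m \<le> e" "a' \<le> m" "c' \<le> m"
      using that by (auto simp: bi_indices_def)
    have "n + m - (a + a') = (n - a) + (m - a')" "n + m - (c + c') = (n - c) + (m - c')"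
      using le by auto
    then have "(\<lambda>p. bimonomial i p * bimonomial j p) = bimonomial (n + m, a + a', c + c')"
      unfolding ij by (auto simp: bimonomial_def power_add)
    moreover have "(n + m, a + a', c + c') \<in> bi_indices (d + e)"
      using le by (auto simp: bi_indices_def)
    ultimately show ?thesis using bi_span_basis by simp
  qed
  have "bi_span (d + e) (\<lambda>p. \<Sum>i\<in>bi_indices d. \<Sum>j\<in>bi_indices e.
      (C i * D j) * (bimonomial i p * bimonomial j p))"
    by (intro bi_span_sum bi_span_scale prod finite_bi_indices)
  then show ?thesis unfolding f g by (simp add: sum_product mult_ac)
qed

lemma bi_span_1: "bi_span d (\<lambda>_. 1)"
  using bi_span_basis[of "(0, 0, 0)" d] by (simp add: bi_indices_def bimonomial_def)

lemma bi_span_mono: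
  assumes "bi_span d f" "d \<le> e"
  shows "bi_span e f"
  using bi_span_mult[OF assms(1) bi_span_1[of "e - d"]] assms(2) by simp

lemma bi_span_power: "bi_span d f \<Longrightarrow> bi_span (n * d) (\<lambda>p. f p ^ n)"
  by (induction n) (auto simp: bi_span_1 intro: bi_span_mult)

lemma bi_span_coordinate: "bi_span 1 (\<lambda>p. segre p $ i)"
proof -
  have "(1, a, c) \<in> bi_indices 1" if "a \<le> 1" "c \<le> 1" for a c
    using that by (simp add: bi_indices_def)
  from bi_span_basis[OF this]
  have b: "bi_span 1 (bimonomial (1, a, c))" if "a \<le> 1" "c \<le> 1" for a c
    using that by blast
  show ?thesis
    using b[of 1 1] b[of 0 0] b[of 1 0] b[of 0 1] exhaust_4[of i]
    by (auto simp: segre_def vector_4 bimonomial_def)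
qed

lemma segre_coordinate_ring_growth:
  assumes "real_polynomial_function f"
  shows "\<exists>d. bi_span d (\<lambda>p. f (segre p))"
  using assms
proof (induction f rule: real_polynomial_function.induct)
  case (linear f)
  interpret bounded_linear f by fact
  have "f v = (\<Sum>i\<in>UNIV. f (axis i 1) * v $ i)" for v
  proof -
    have "f v = f (\<Sum>i\<in>UNIV. v $ i *\<^sub>R axis i 1)"
      using basis_expansion[of v] by (simp add: scalar_mult_eq_scaleR)
    then show ?thesis by (simp add: sum scaleR mult.commute)
  qed
  then have "(\<lambda>p. f (segre p)) = (\<lambda>p. \<Sum>i\<in>UNIV. f (axis i 1) * segre p $ i)"
    by (rule ext)
  moreover have "bi_span 1 (\<lambda>p. \<Sum>i\<in>UNIV. f (axis i 1) * segre p $ i)"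
    by (intro bi_span_sum bi_span_scale bi_span_coordinate) simp
  ultimately show ?case by metis
next
  case (const c)
  show ?case using bi_span_scale[OF bi_span_1, of 0 c] by auto
next
  case (add f g)
  then obtain d e where "bi_span d (\<lambda>p. f (segre p))" "bi_span e (\<lambda>p. g (segre p))" by blast
  then have "bi_span (max d e) (\<lambda>p. f (segre p) + g (segre p))"
    by (intro bi_span_add) (auto intro: bi_span_mono)
  then show ?case by blast
next
  case (mult f g)
  then show ?case using bi_span_mult by blast
qed

lemma bi_span_monomial:
  assumes "\<forall>f\<in>set fs. bi_span e (\<lambda>p. f (segre p))" "\<alpha> \<in> exponents N (length fs)"
  shows "bi_span (length fs * (N * e)) (\<lambda>p. monomial fs \<alpha> (segre p))"
  using assms
proof (induction fs arbitrary: \<alpha>)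
  case Nil
  then show ?case by (simp add: bi_span_1)
next
  case (Cons f fs)
  then obtain a \<beta> where \<alpha>: "\<alpha> = a # \<beta>" "a < N" "\<beta> \<in> exponents N (length fs)"
    by (auto simp: exponents_Suc)
  have "bi_span (a * e) (\<lambda>p. f (segre p) ^ a)"
    using Cons.prems by (intro bi_span_power) simp
  then have "bi_span (N * e) (\<lambda>p. f (segre p) ^ a)"
    by (rule bi_span_mono) (use \<alpha>(2) in simp)
  from bi_span_mult[OF this Cons.IH[OF _ \<alpha>(3)]] Cons.prems(1) show ?case
    by (simp add: \<alpha>(1))
qed

lemma alg_indep_V_length_neq_4:
  assumes poly: "\<forall>f\<in>set fs. real_polynomial_function f" and ind: "alg_indep V fs"
  shows "length fs \<noteq> 4"
proof
  assume len: "length fs = 4"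
  have "\<exists>e. \<forall>f\<in>set fs. bi_span e (\<lambda>p. f (segre p))"
    using poly
  proof (induction fs)
    case (Cons f fs)
    then obtain e where e: "\<forall>f\<in>set fs. bi_span e (\<lambda>p. f (segre p))" by auto
    obtain d where "bi_span d (\<lambda>p. f (segre p))"
      using Cons.prems segre_coordinate_ring_growth by auto
    with e have "\<forall>g\<in>set (f # fs). bi_span (max d e) (\<lambda>p. g (segre p))"
      by (auto intro: bi_span_mono)
    then show ?case by blast
  qed simp
  then obtain e where e: "\<forall>f\<in>set fs. bi_span e (\<lambda>p. f (segre p))" by blast
  \<comment> \<open>Large enough for the inequality \<open>(4 N e + 1)\<^sup>3 < N\<^sup>4\<close>.\<close>
  define N where "N = (4 * e + 1) ^ 3 + 1"
  define D where "D = 4 * (N * e)"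
  have "\<forall>\<alpha>\<in>exponents N 4. \<exists>C. (\<lambda>p. monomial fs \<alpha> (segre p)) = (\<lambda>p. \<Sum>i\<in>bi_indices D. C i * bimonomial i p)"
    using bi_span_monomial[OF e] unfolding len D_def bi_span_def by blast
  then obtain C where C: "\<And>\<alpha>. \<alpha> \<in> exponents N 4 \<Longrightarrow>
      (\<lambda>p. monomial fs \<alpha> (segre p)) = (\<lambda>p. \<Sum>i\<in>bi_indices D. C \<alpha> i * bimonomial i p)"
    by metis
  have "card (bi_indices D) \<le> (D + 1) ^ 3" by (rule card_bi_indices_le)
  also have "\<dots> \<le> ((4 * e + 1) * N) ^ 3"
    by (rule power_mono) (auto simp: D_def N_def algebra_simps)
  also have "\<dots> = (4 * e + 1) ^ 3 * N ^ 3" by (rule power_mult_distrib)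
  also have "\<dots> < N * N ^ 3"
    by (rule mult_strict_right_mono) (auto simp: N_def)
  also have "\<dots> = card (exponents N 4)" by (simp add: card_exponents eval_nat_numeral)
  finally have "card (bi_indices D) < card (exponents N 4)" .
  from homogeneous_system_nontrivial_solution[OF finite_bi_indices finite_exponents this, of C]
  obtain c where c: "\<exists>\<alpha>\<in>exponents N 4. c \<alpha> \<noteq> 0"
    "\<forall>i\<in>bi_indices D. (\<Sum>\<alpha>\<in>exponents N 4. c \<alpha> * C \<alpha> i) = 0" by blast
  have "(\<Sum>\<alpha>\<in>exponents N 4. c \<alpha> * monomial fs \<alpha> x) = 0" if x: "x \<in> V" for x
  proof -
    obtain p where p: "x = segre p" using x range_segre by blast
    have "(\<Sum>\<alpha>\<in>exponents N 4. c \<alpha> * monomial fs \<alpha> x)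
        = (\<Sum>\<alpha>\<in>exponents N 4. \<Sum>i\<in>bi_indices D. c \<alpha> * C \<alpha> i * bimonomial i p)"
      by (rule sum.cong) (auto simp: p fun_cong[OF C] sum_distrib_left mult.assoc)
    also have "\<dots> = (\<Sum>i\<in>bi_indices D. (\<Sum>\<alpha>\<in>exponents N 4. c \<alpha> * C \<alpha> i) * bimonomial i p)"
      unfolding sum_distrib_right by (rule sum.swap)
    also have "\<dots> = 0" using c(2) by (auto intro: sum.neutral)
    finally show ?thesis .
  qed
  with ind c(1) show False unfolding alg_indep_def len by blast
qed

lemma variety_dim_V_le: "variety_dim V \<le> 3"
  unfolding variety_dim_def
proof (rule Sup_least, clarify)
  fix n and Z :: "nat \<Rightarrow> (real^4) set"
  assume irr: "\<forall>i\<le>n. irreducible_variety (Z i) \<and> Z i \<subseteq> V" and chain: "\<forall>i<n. Z i \<subset> Z (Suc i)"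
  have "n \<le> 3"
  proof (rule ccontr)
    assume "\<not> n \<le> 3"
    then obtain fs where "length fs = 4" "\<forall>f\<in>set fs. real_polynomial_function f" "alg_indep (Z 4) fs"
      using chain_alg_indep[of 4 Z] irr chain by auto
    moreover have "Z 4 \<subseteq> V" using irr \<open>\<not> n \<le> 3\<close> by simp
    ultimately show False using alg_indep_V_length_neq_4 alg_indep_mono by blast
  qed
  then show "enat n \<le> 3" by (simp add: numeral_eq_enat)
qed

section \<open>The cone on the torus\<close>

lemma homeomorphic_space_same_fibres:
  assumes f: "quotient_map X Y f" and g: "quotient_map X Z g"
    and fib: "\<And>x y. x \<in> topspace X \<Longrightarrow> y \<in> topspace X \<Longrightarrow> f x = f y \<longleftrightarrow> g x = g y"
  shows "Y homeomorphic_space Z"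
proof -
  obtain h where h: "continuous_map Y Z h" "\<And>x. x \<in> topspace X \<Longrightarrow> h (f x) = g x"
    using quotient_map_lift_exists[OF f quotient_imp_continuous_map[OF g]] fib by metis
  obtain k where k: "continuous_map Z Y k" "\<And>x. x \<in> topspace X \<Longrightarrow> k (g x) = f x"
    using quotient_map_lift_exists[OF g quotient_imp_continuous_map[OF f]] fib by metis
  have "topspace Y = f ` topspace X" "topspace Z = g ` topspace X"
    using quotient_imp_surjective_map[OF f] quotient_imp_surjective_map[OF g] by simp_all
  then have "homeomorphic_maps Y Z h k"
    unfolding homeomorphic_maps_def using h k by auto
  then show ?thesis by (auto simp: homeomorphic_space_def)
qed

text \<open>The model of \<open>V\<close> that is visibly a cone: it is invariant under scaling, and its part of
  modulus one is the torus.\<close>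

definition equal_modulus_pairs :: "(complex \<times> complex) set" where
  "equal_modulus_pairs = {(\<xi>, \<eta>). norm \<xi> = norm \<eta>}"

lemma V_homeomorphic_equal_modulus_pairs:
  "top_of_set V homeomorphic_space top_of_set equal_modulus_pairs"
proof -
  \<comment> \<open>In the coordinates \<open>x = p + q\<close>, \<open>y = p - q\<close>, \<open>z = r + s\<close>, \<open>w = r - s\<close>, the pair is
    \<open>(p + \<i>s, r + \<i>q)\<close>.\<close>
  define f :: "real^4 \<Rightarrow> complex \<times> complex" where
    "f = (\<lambda>v. (Complex ((v $ 1 + v $ 2) / 2) ((v $ 3 - v $ 4) / 2),
               Complex ((v $ 3 + v $ 4) / 2) ((v $ 1 - v $ 2) / 2)))"
  define g :: "complex \<times> complex \<Rightarrow> real^4" where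
    "g = (\<lambda>z. vector [Re (fst z) + Im (snd z), Re (fst z) - Im (snd z),
                      Re (snd z) + Im (fst z), Re (snd z) - Im (fst z)])"
  have cont_f: "continuous_on V f"
    unfolding f_def Complex_eq by (intro continuous_intros) simp_all
  have cont_g: "continuous_on equal_modulus_pairs g"
    unfolding g_def
    by (intro continuous_on_polymonial_function polynomial_function_vector4 polynomial_function_intros
        polynomial_function_linear_compose[OF bounded_linear_Re]
        polynomial_function_linear_compose[OF bounded_linear_Im])
  have gf: "g (f v) = v" for v
    by (auto simp: f_def g_def vec_eq_iff forall_4 vector_4 field_simps)
  have fg: "f (g z) = z" for z
    by (cases z) (auto simp: f_def g_def vector_4 complex_eq_iff)
  have norm_f: "norm (fst (f v)) = norm (snd (f v)) \<longleftrightarrow> v \<in> V" for v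
  proof -
    have "norm (fst (f v)) = norm (snd (f v)) \<longleftrightarrow> (norm (fst (f v)))\<^sup>2 = (norm (snd (f v)))\<^sup>2"
      by (simp add: power2_eq_iff_nonneg)
    also have "\<dots> \<longleftrightarrow> v $ 1 * v $ 2 = v $ 3 * v $ 4"
      unfolding cmod_power2 f_def by (simp add: power2_eq_square field_simps)
    finally show ?thesis by (simp add: V_def)
  qed
  have fV: "f ` V \<subseteq> equal_modulus_pairs"
    using norm_f by (auto simp: equal_modulus_pairs_def split_def)
  have gV: "g ` equal_modulus_pairs \<subseteq> V"
    using norm_f[of "g z" for z] by (auto simp: equal_modulus_pairs_def fg)
  have "homeomorphic_maps (top_of_set V) (top_of_set equal_modulus_pairs) f g"
    unfolding homeomorphic_maps_def continuous_map_in_subtopology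
    using cont_f cont_g fV gV gf fg by auto
  then show ?thesis by (auto simp: homeomorphic_space_def)
qed

lemma open_cone_torus_homeomorphic:
  "open_cone torus homeomorphic_space top_of_set equal_modulus_pairs"
proof -
  define S :: "((complex \<times> complex) \<times> real) set" where "S = (sphere 0 1 \<times> sphere 0 1) \<times> {0..<1}"
  define F :: "(complex \<times> complex) \<times> real \<Rightarrow> complex \<times> complex" where
    "F = (\<lambda>z. (snd z / (1 - snd z)) *\<^sub>R fst z)"
  have X: "prod_topology torus (top_of_set {0..<1}) = top_of_set S"
    by (simp add: torus_def S_def)
  have cont: "continuous_on ((sphere 0 1 \<times> sphere 0 1) \<times> {0..r}) F" if "r < 1" for r
    unfolding F_def by (intro continuous_intros) (use that in auto)
  have contS: "continuous_on S F"
    unfolding F_def S_def by (intro continuous_intros) auto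
  have im: "F ` S = equal_modulus_pairs"
  proof
    show "F ` S \<subseteq> equal_modulus_pairs"
      by (auto simp: F_def S_def equal_modulus_pairs_def)
    show "equal_modulus_pairs \<subseteq> F ` S"
    proof
      fix z assume "z \<in> equal_modulus_pairs"
      then obtain \<xi> \<eta> where z: "z = (\<xi>, \<eta>)" "norm \<xi> = norm \<eta>"
        by (auto simp: equal_modulus_pairs_def)
      show "z \<in> F ` S"
      proof (cases "\<xi> = 0")
        case True
        then show ?thesis
          using z by (intro image_eqI[of _ _ "((1, 1), 0)"]) (auto simp: F_def S_def)
      next
        case False
        define r where "r = norm \<xi>"
        have r: "r > 0" "norm \<eta> = r" using False z by (auto simp: r_def)
        \<comment> \<open>The inverse of \<open>t \<mapsto> t / (1 - t)\<close> on \<open>[0, 1)\<close> is \<open>r \<mapsto> r / (1 + r)\<close>.\<close>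
        have t: "(r / (1 + r)) / (1 - r / (1 + r)) = r"
          using r by (simp add: field_simps)
        have t1: "r / (1 + r) < 1" using r by simp
        have "((\<xi> /\<^sub>R r, \<eta> /\<^sub>R r), r / (1 + r)) \<in> S"
          using r t1 by (simp add: S_def r_def)
        moreover have "F ((\<xi> /\<^sub>R r, \<eta> /\<^sub>R r), r / (1 + r)) = z"
          unfolding F_def snd_conv t using r z by simp
        ultimately show ?thesis by (metis image_eqI)
      qed
    qed
  qed
  have proper: "compact (S \<inter> F -` U)" if U: "U \<subseteq> equal_modulus_pairs" "compact U" for U
  proof -
    obtain M where M: "M \<ge> 0" "\<And>u. u \<in> U \<Longrightarrow> norm (fst u) \<le> M"
    proof -
      have "bounded (fst ` U)"
        using U(2) by (intro compact_imp_bounded compact_continuous_image continuous_intros)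
      then obtain b where "b > 0" "\<forall>u\<in>fst ` U. norm u \<le> b" unfolding bounded_pos by blast
      then show thesis by (intro that[of b]) auto
    qed
    \<comment> \<open>The preimage of \<open>U\<close> stays away from the missing end \<open>t = 1\<close>, since \<open>t / (1 - t) \<le> M\<close> on it.\<close>
    define K :: "((complex \<times> complex) \<times> real) set"
      where "K = (sphere 0 1 \<times> sphere 0 1) \<times> {0..M / (1 + M)}"
    have r: "M / (1 + M) < 1" using M(1) by simp
    have K: "compact K" unfolding K_def by (intro compact_Times compact_sphere compact_Icc)
    have "S \<inter> F -` U = K \<inter> F -` U"
    proof -
      have "z \<in> K" if "z \<in> S" "F z \<in> U" for z
      proof -
        obtain \<alpha> \<beta> t where z: "z = ((\<alpha>, \<beta>), t)" by (metis prod.exhaust)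
        have t: "0 \<le> t" "t < 1" and n: "norm \<alpha> = 1" using that(1) by (auto simp: z S_def)
        have "norm (fst (F z)) = t / (1 - t)"
          using t n by (simp add: F_def z)
        with M(2)[OF that(2)] have "t / (1 - t) \<le> M" by simp
        then have "t \<le> M / (1 + M)"
          using t M(1) by (simp add: field_simps)
        then show ?thesis using that(1) by (auto simp: z S_def K_def)
      qed
      moreover have "K \<subseteq> S" using r by (auto simp: K_def S_def)
      ultimately show ?thesis by auto
    qed
    moreover have "closed (K \<inter> F -` U)"
      using continuous_closed_preimage[OF cont[OF r], of U] K U(2)
      by (simp add: K_def[symmetric] compact_imp_closed)
    then have "compact (K \<inter> F -` U)"
      using compact_Int_closed[OF K, of "K \<inter> F -` U"] by simp
    ultimately show ?thesis by simp
  qed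
  have F: "quotient_map (top_of_set S) (top_of_set equal_modulus_pairs) F"
  proof (rule continuous_closed_imp_quotient_map)
    show "continuous_map (top_of_set S) (top_of_set equal_modulus_pairs) F"
      using contS im by (auto simp: continuous_map_in_subtopology)
    show "closed_map (top_of_set S) (top_of_set equal_modulus_pairs) F"
      unfolding closed_map_def using proper_map[of S _ equal_modulus_pairs F] proper im by blast
  qed (simp add: im)
  define q where "q = (\<lambda>(x, t::real). if t = 0 then topspace torus \<times> {0} else {(x, t)})"
  have q: "quotient_map (top_of_set S) (open_cone torus) q"
    unfolding open_cone_def X q_def by (rule quotient_map_quotient_topology)
  show ?thesis
  proof (rule homeomorphic_space_same_fibres[OF q F])
    fix z w assume zw: "z \<in> topspace (top_of_set S)" "w \<in> topspace (top_of_set S)"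
    obtain \<alpha> \<beta> t \<alpha>' \<beta>' t' where z: "z = ((\<alpha>, \<beta>), t)" and w: "w = ((\<alpha>', \<beta>'), t')"
      by (metis prod.exhaust)
    have n: "norm \<alpha> = 1" "norm \<alpha>' = 1" "0 \<le> t" "t < 1" "0 \<le> t'" "t' < 1"
      using zw by (auto simp: z w S_def)
    have radius: "norm (fst (F z)) = t / (1 - t)" "norm (fst (F w)) = t' / (1 - t')"
      using n by (simp_all add: F_def z w)
    have tt': "t = t'" if "F z = F w"
      using radius that n by (simp add: field_simps)
    have "q z = q w \<longleftrightarrow> t = t' \<and> (t = 0 \<or> (\<alpha> = \<alpha>' \<and> \<beta> = \<beta>'))"
      by (auto simp: q_def z w)
    also have "\<dots> \<longleftrightarrow> F z = F w"
      using tt' n by (auto simp: F_def z w)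
    finally show "q z = q w \<longleftrightarrow> F z = F w" .
  qed
qed

theorem theorem1p2:
  shows "isomorphic_varieties Hom_Z2_Heis0 (V \<times> (UNIV :: (real^2) set)) \<and>
         variety_dim V = 3 \<and>
         top_of_set Hom_Z2_Heis0 homeomorphic_space
           prod_topology (euclidean :: (real^2) topology) (open_cone torus)"
proof (intro conjI)
  show "isomorphic_varieties Hom_Z2_Heis0 (V \<times> (UNIV :: (real^2) set))"
    by (rule Hom_isomorphic_V_times_plane)
  show "variety_dim V = 3"
    by (rule antisym[OF variety_dim_V_le variety_dim_V_ge])
  have "top_of_set V homeomorphic_space open_cone torus"
    by (rule homeomorphic_space_trans[OF V_homeomorphic_equal_modulus_pairs
          open_cone_torus_homeomorphic[THEN homeomorphic_space_sym[THEN iffD1]]])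
  then have "prod_topology (top_of_set V) (euclidean :: (real^2) topology) homeomorphic_space
      prod_topology (open_cone torus) (euclidean :: (real^2) topology)"
    by (rule homeomorphic_space_prod_topology[OF _ homeomorphic_space_refl])
  also have "prod_topology (top_of_set V) (euclidean :: (real^2) topology)
      = top_of_set (V \<times> UNIV)"
    using prod_topology_subtopology_eu[of V "UNIV :: (real^2) set"] by simp
  finally have "top_of_set (V \<times> (UNIV :: (real^2) set)) homeomorphic_space
      prod_topology (open_cone torus) (euclidean :: (real^2) topology)" .
  note homeomorphic_space_trans[OF this homeomorphic_space_prod_topology_swap]
  then show "top_of_set Hom_Z2_Heis0 homeomorphic_space
      prod_topology (euclidean :: (real^2) topology) (open_cone torus)"
    by (rule homeomorphic_space_trans[OF
          isomorphic_varieties_homeomorphic[OF Hom_isomorphic_V_times_plane]])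
qed

end
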